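(* Let $\gamma=z+wj\in\mathcal{L}$, with $z,w\in\mathbb{Z}[i]$, be a Lipschitz integer whose norm $\mathrm{N}(\gamma)$ is odd. Then the right ideal $i\gamma\mathcal{H}+\gamma\mathcal{H}$ of $\mathcal{H}$ is equal to $\mathcal{H}$ if and only if $z$ and $w$ are coprime in $\mathbb{Z}[i]$.
   Context: $\mathbb{H}$ is the real quaternion algebra with basis $1,i,j,k$ ($i^2=j^2=k^2=ijk=-1$), with conjugation $u\mapsto\bar u$ and norm $\mathrm{N}(u)=u\bar{u}$. $\mathcal{L}=\mathbb{Z}+\mathbb{Z}i+\mathbb{Z}j+\mathbb{Z}k$ is the ring of Lipschitz integers, and $\mathcal{H}=\mathcal{L}\cup(\omega+\mathcal{L})$, with $\omega=\frac12(1+i+j+k)$, is the ring of Hurwitz integers. $\mathbb{Z}[i]=\mathbb{Z}+\mathbb{Z}i\subset\mathcal{L}$ is the ring of Gaussian integers; every element of $\mathcal{L}$ is uniquely of the form $z+wj$ with $z,w\in\mathbb{Z}[i]$. *)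

theory Defs
  imports Complex_Main "HOL-Library.Set_Algebras"
begin

section \<open>The real quaternion algebra\<close>

text \<open>\<open>Quat a b c d\<close> is the quaternion $a + bi + cj + dk$.\<close>

datatype quat = Quat (qre: real) (qi: real) (qj: real) (qk: real)

lemma quat_eq_iff: "p = q \<longleftrightarrow> qre p = qre q \<and> qi p = qi q \<and> qj p = qj q \<and> qk p = qk q"
  by (cases p; cases q) simp

instantiation quat :: real_algebra_1
begin

definition "0 = Quat 0 0 0 0"

definition "1 = Quat 1 0 0 0"

definition "p + q = Quat (qre p + qre q) (qi p + qi q) (qj p + qj q) (qk p + qk q)"

definition "- p = Quat (- qre p) (- qi p) (- qj p) (- qk p)"

definition "p - q = Quat (qre p - qre q) (qi p - qi q) (qj p - qj q) (qk p - qk q)"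

definition "r *\<^sub>R p = Quat (r * qre p) (r * qi p) (r * qj p) (r * qk p)"

definition "p * q = Quat
  (qre p * qre q - qi p * qi q - qj p * qj q - qk p * qk q)
  (qre p * qi q + qi p * qre q + qj p * qk q - qk p * qj q)
  (qre p * qj q - qi p * qk q + qj p * qre q + qk p * qi q)
  (qre p * qk q + qi p * qj q - qj p * qi q + qk p * qre q)"

instance
  by standard
    (simp_all add: quat_eq_iff zero_quat_def one_quat_def plus_quat_def uminus_quat_def
      minus_quat_def scaleR_quat_def times_quat_def algebra_simps)

end

lemmas quat_defs = zero_quat_def one_quat_def plus_quat_def uminus_quat_def
  minus_quat_def scaleR_quat_def times_quat_def

definition quat_i :: quat where "quat_i = Quat 0 1 0 0"
definition quat_j :: quat where "quat_j = Quat 0 0 1 0"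
definition quat_k :: quat where "quat_k = Quat 0 0 0 1"

lemma quat_units_mult:
  "quat_i * quat_i = - 1" "quat_j * quat_j = - 1" "quat_k * quat_k = - 1"
  "quat_i * quat_j * quat_k = - 1"
  by (simp_all add: quat_i_def quat_j_def quat_k_def quat_defs)

lemma of_real_quat: "of_real r = Quat r 0 0 0"
  by (simp add: of_real_def quat_defs)

lemma of_int_quat: "of_int n = Quat (of_int n) 0 0 0"
  using of_real_quat[of "of_int n"] by simp

lemma quat_expand:
  "Quat a b c d = of_real a + of_real b * quat_i + of_real c * quat_j + of_real d * quat_k"
  by (simp add: of_real_quat quat_i_def quat_j_def quat_k_def quat_defs)

definition quat_conj :: "quat \<Rightarrow> quat"
  where "quat_conj q = Quat (qre q) (- qi q) (- qj q) (- qk q)"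

text \<open>The norm is kept as an element of the algebra; it lies in the subfield of reals.\<close>

definition quat_norm :: "quat \<Rightarrow> quat"
  where "quat_norm q = q * quat_conj q"

lemma quat_norm_eq: "quat_norm q = of_real ((qre q)\<^sup>2 + (qi q)\<^sup>2 + (qj q)\<^sup>2 + (qk q)\<^sup>2)"
  by (simp add: quat_norm_def quat_conj_def of_real_quat quat_defs power2_eq_square)


section \<open>Lipschitz and Hurwitz integers\<close>

definition lipschitz :: "quat set"
  where "lipschitz = {of_int a + of_int b * quat_i + of_int c * quat_j + of_int d * quat_k | a b c d. True}"

definition quat_omega :: quat
  where "quat_omega = (1 / 2) *\<^sub>R (1 + quat_i + quat_j + quat_k)"

definition hurwitz :: "quat set"
  where "hurwitz = lipschitz \<union> (quat_omega +o lipschitz)"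


section \<open>Gaussian integers\<close>

text \<open>
  \<open>Gauss a b\<close> is $a + bi$. The type is made an instance of \<^class>\<open>algebraic_semidom\<close> so that
  the library constant \<^const>\<open>coprime\<close> is available on it. Division rounds both
  coordinates of the exact quotient to a nearest integer; divisibility and coprimality
  depend only on the multiplication.
\<close>

datatype gauss_int = Gauss (gre: int) (gim: int)

lemma gauss_eq_iff: "x = y \<longleftrightarrow> gre x = gre y \<and> gim x = gim y"
  by (cases x; cases y) simp

instantiation gauss_int :: comm_ring_1
begin

definition "0 = Gauss 0 0"

definition "1 = Gauss 1 0"

definition "x + y = Gauss (gre x + gre y) (gim x + gim y)"

definition "- x = Gauss (- gre x) (- gim x)"

definition "x - y = Gauss (gre x - gre y) (gim x - gim y)"

definition "x * y = Gauss (gre x * gre y - gim x * gim y) (gre x * gim y + gim x * gre y)"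

instance
  by standard
    (simp_all add: gauss_eq_iff zero_gauss_int_def one_gauss_int_def plus_gauss_int_def
      uminus_gauss_int_def minus_gauss_int_def times_gauss_int_def algebra_simps)

end

lemmas gauss_defs = zero_gauss_int_def one_gauss_int_def plus_gauss_int_def
  uminus_gauss_int_def minus_gauss_int_def times_gauss_int_def

definition gauss_norm :: "gauss_int \<Rightarrow> int"
  where "gauss_norm x = (gre x)\<^sup>2 + (gim x)\<^sup>2"

lemma gauss_norm_mult: "gauss_norm (x * y) = gauss_norm x * gauss_norm y"
  by (simp add: gauss_norm_def gauss_defs power2_eq_square algebra_simps)

lemma gauss_norm_eq_0_iff: "gauss_norm x = 0 \<longleftrightarrow> x = 0"
  by (simp add: gauss_norm_def gauss_eq_iff zero_gauss_int_def sum_power2_eq_zero_iff)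

lemma gauss_norm_pos: "x \<noteq> 0 \<Longrightarrow> gauss_norm x > 0"
  by (simp add: gauss_norm_def gauss_eq_iff zero_gauss_int_def sum_power2_gt_zero_iff)

lemma int_round_div_mult:
  fixes k n :: int
  assumes "n > 0"
  shows "(k * n + n div 2) div n = k"
  using assms by (simp add: div_pos_pos_trivial)

instantiation gauss_int :: algebraic_semidom
begin

definition "x div y = (if y = 0 then 0 else
  (let n = gauss_norm y in
     Gauss ((gre x * gre y + gim x * gim y + n div 2) div n)
           ((gim x * gre y - gre x * gim y + n div 2) div n)))"

instance
proof
  fix x y :: gauss_int
  show "x \<noteq> 0 \<Longrightarrow> y \<noteq> 0 \<Longrightarrow> x * y \<noteq> 0"
    by (metis gauss_norm_eq_0_iff gauss_norm_mult mult_eq_0_iff)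
  show "x div 0 = 0"
    by (simp add: divide_gauss_int_def)
  assume "y \<noteq> 0"
  have "gre (x * y) * gre y + gim (x * y) * gim y = gre x * gauss_norm y"
    "gim (x * y) * gre y - gre (x * y) * gim y = gim x * gauss_norm y"
    by (simp_all add: gauss_norm_def gauss_defs power2_eq_square algebra_simps)
  then show "x * y div y = x"
    using \<open>y \<noteq> 0\<close> gauss_norm_pos[of y]
    by (simp add: divide_gauss_int_def Let_def int_round_div_mult)
qed

end

text \<open>The inclusion of the Gaussian integers into the quaternions.\<close>

definition quat_of_gauss :: "gauss_int \<Rightarrow> quat"
  where "quat_of_gauss x = of_int (gre x) + of_int (gim x) * quat_i"

lemma quat_of_gauss_hom:
  "quat_of_gauss 0 = 0" "quat_of_gauss 1 = 1"
  "quat_of_gauss (x + y) = quat_of_gauss x + quat_of_gauss y"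
  "quat_of_gauss (x * y) = quat_of_gauss x * quat_of_gauss y"
  by (simp_all add: quat_of_gauss_def of_int_quat quat_i_def quat_defs gauss_defs)

lemma quat_of_gauss_plus_j:
  "quat_of_gauss z + quat_of_gauss w * quat_j = Quat (gre z) (gim z) (gre w) (gim w)"
  by (simp add: quat_of_gauss_def of_int_quat quat_i_def quat_j_def quat_defs)

lemma lipschitz_unique_gauss:
  "q \<in> lipschitz \<longleftrightarrow> (\<exists>!(z, w). q = quat_of_gauss z + quat_of_gauss w * quat_j)"
proof -
  have "q \<in> lipschitz \<longleftrightarrow> (\<exists>a b c d. q = Quat (of_int a) (of_int b) (of_int c) (of_int d))"
    by (simp add: lipschitz_def quat_expand)
  also have "\<dots> \<longleftrightarrow> (\<exists>z w. q = quat_of_gauss z + quat_of_gauss w * quat_j)"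
    unfolding quat_of_gauss_plus_j by (metis gauss_int.sel)
  also have "\<dots> \<longleftrightarrow> (\<exists>!(z, w). q = quat_of_gauss z + quat_of_gauss w * quat_j)"
    unfolding quat_of_gauss_plus_j
    by (fastforce simp: Ex1_def gauss_eq_iff)
  finally show ?thesis .
qed

end

theory Submission
  imports Defs
begin

text \<open>
  Conjugating by \<open>i\<close> separates the two components of \<open>\<gamma> = z + w j\<close>:
  \<open>i\<gamma> + \<gamma>i = 2zi\<close> and \<open>i\<gamma> - \<gamma>i = 2wk\<close>, so the right ideal contains \<open>2z\<close> and \<open>2w\<close>, and also
  the odd integer \<open>N(\<gamma>)\<close>. If \<open>z\<close> and \<open>w\<close> are coprime, Bezout's identity in the Gaussian integers puts
  \<open>2\<close> in the ideal, hence \<open>1\<close>. Conversely a common divisor \<open>d\<close> of \<open>z\<close> and \<open>w\<close> is a left divisor of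
  every element of the ideal, because Gaussian integers commute with \<open>i\<close>; if \<open>1 = d h\<close>
  with \<open>h\<close> Hurwitz, then \<open>h\<close> is a Gaussian integer and \<open>d\<close> is a unit.
\<close>

section \<open>Bezout's identity in the Gaussian integers\<close>

lemma int_nearest_multiple:
  fixes a n :: int
  assumes "n > 0"
  obtains k where "2 * \<bar>a - k * n\<bar> \<le> n"
proof (cases "2 * (a mod n) \<le> n")
  case True
  have "a - (a div n) * n = a mod n" by (simp add: minus_div_mult_eq_mod)
  then show thesis using that[of "a div n"] True assms by simp
next
  case False
  have "a - (a div n + 1) * n = a mod n - n" by (simp add: algebra_simps minus_div_mult_eq_mod)
  moreover have "a mod n < n" using assms by simp
  ultimately show thesis using that[of "a div n + 1"] False by simp
qed

text \<open>The exact quotient of \<open>x\<close> by \<open>y\<close> is \<open>x\<close> times the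
  conjugate of \<open>y\<close>, over the norm of \<open>y\<close>. Rounding both coordinates to
  nearest integers gives \<open>q\<close> and leaves a remainder of norm at most half that of
  \<open>y\<close>.\<close>

lemma gauss_division:
  assumes "y \<noteq> 0"
  obtains q where "gauss_norm (x - y * q) < gauss_norm y"
proof -
  define n where "n = gauss_norm y"
  have n: "n > 0" using assms gauss_norm_pos n_def by simp
  let ?c = "Gauss (gre y) (- gim y)"
  obtain k where k: "2 * \<bar>gre (x * ?c) - k * n\<bar> \<le> n" using int_nearest_multiple[OF n] .
  obtain l where l: "2 * \<bar>gim (x * ?c) - l * n\<bar> \<le> n" using int_nearest_multiple[OF n] .
  have sq: "4 * t\<^sup>2 \<le> n\<^sup>2" if "2 * \<bar>t\<bar> \<le> n" for t :: int
    using power_mono[OF that, of 2] by (simp add: power_mult_distrib)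
  \<comment> \<open>Multiplying by the conjugate \<open>?c\<close> turns the divisor into the
    integer \<open>n\<close>, so the two coordinates can be bounded separately.\<close>
  have "gauss_norm (x - y * Gauss k l) * n = gauss_norm ((x - y * Gauss k l) * ?c)"
    by (simp add: gauss_norm_mult n_def) (simp add: gauss_norm_def)
  also have "(x - y * Gauss k l) * ?c = Gauss (gre (x * ?c) - k * n) (gim (x * ?c) - l * n)"
    by (simp add: n_def gauss_norm_def gauss_defs power2_eq_square algebra_simps)
  also have "4 * gauss_norm \<dots> \<le> 2 * n\<^sup>2"
    using sq[OF k] sq[OF l] by (simp add: gauss_norm_def)
  finally have "gauss_norm (x - y * Gauss k l) * n \<le> n\<^sup>2 div 2" by linarith
  also have "\<dots> < n * n" using mult_pos_pos[OF n n] unfolding power2_eq_square by linarith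
  finally show thesis using that n n_def by simp
qed

text \<open>Euclid's algorithm: the pair \<open>(z, w)\<close> is replaced by
  \<open>(w, z - w * q)\<close>, which stays coprime while the norm of the second entry
  drops.\<close>

lemma coprime_gauss_bezout:
  fixes z w :: gauss_int
  assumes "coprime z w"
  obtains x y where "z * x + w * y = 1"
proof -
  have "\<exists>x y. z * x + w * y = 1"
    using assms
  proof (induction "nat (gauss_norm w)" arbitrary: z w rule: less_induct)
    case less
    show ?case
    proof (cases "w = 0")
      case True
      then have "z dvd 1" using less.prems by simp
      then show ?thesis unfolding dvd_def using True by (metis add.right_neutral mult_zero_left)
    next
      case False
      obtain q where q: "gauss_norm (z - w * q) < gauss_norm w"
        using gauss_division[OF False] .
      have "coprime w (z - w * q)"
      proof (rule coprimeI)
        fix d assume "d dvd w" "d dvd z - w * q"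
        then have "d dvd (z - w * q) + w * q" by (metis dvd_add dvd_mult2)
        then have "d dvd z" by simp
        with \<open>d dvd w\<close> less.prems show "is_unit d" by (simp add: coprime_common_divisor)
      qed
      moreover have "nat (gauss_norm (z - w * q)) < nat (gauss_norm w)"
        using q gauss_norm_pos[OF False] by simp
      ultimately obtain x y where "w * x + (z - w * q) * y = 1"
        using less.hyps by blast
      then have "z * y + w * (x - q * y) = 1" by (simp add: algebra_simps)
      then show ?thesis by blast
    qed
  qed
  then show thesis using that by blast
qed

section \<open>The ring of Hurwitz integers\<close>

lemma lipschitz_iff:
  "q \<in> lipschitz \<longleftrightarrow> (\<exists>a b c d. q = Quat (of_int a) (of_int b) (of_int c) (of_int d))"
  by (simp add: lipschitz_def quat_expand)

text \<open>Since \<open>1 = 2\<omega> - i - j - k\<close>, the Hurwitz integers have the integral basis \<open>\<omega>, i, j, k\<close>.\<close>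

lemma hurwitz_iff:
  "q \<in> hurwitz \<longleftrightarrow> (\<exists>(n::int) (a::int) (b::int) (c::int). q = Quat (n / 2) (a + n / 2) (b + n / 2) (c + n / 2))"
proof
  assume "q \<in> hurwitz"
  then consider "q \<in> lipschitz" | "q \<in> quat_omega +o lipschitz"
    by (auto simp: hurwitz_def)
  then show "\<exists>(n::int) (a::int) (b::int) (c::int). q = Quat (n / 2) (a + n / 2) (b + n / 2) (c + n / 2)"
  proof cases
    case 1
    then obtain a b c d :: int where "q = Quat a b c d" by (auto simp: lipschitz_iff)
    then have "q = Quat ((2 * a) / 2) ((b - a) + (2 * a) / 2)
        ((c - a) + (2 * a) / 2) ((d - a) + (2 * a) / 2)"
      by simp
    then show ?thesis by (metis of_int_diff of_int_mult of_int_numeral)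
  next
    case 2
    then obtain a b c d :: int where "q = quat_omega + Quat a b c d"
      by (auto simp: lipschitz_iff elt_set_plus_def)
    then have "q = Quat (of_int (2 * a + 1) / 2) (of_int (b - a) + of_int (2 * a + 1) / 2)
        (of_int (c - a) + of_int (2 * a + 1) / 2) (of_int (d - a) + of_int (2 * a + 1) / 2)"
      by (simp add: quat_omega_def quat_defs quat_i_def quat_j_def quat_k_def field_simps)
    then show ?thesis by blast
  qed
next
  assume "\<exists>(n::int) (a::int) (b::int) (c::int). q = Quat (n / 2) (a + n / 2) (b + n / 2) (c + n / 2)"
  then obtain n a b c :: int where q: "q = Quat (n / 2) (a + n / 2) (b + n / 2) (c + n / 2)"
    by blast
  show "q \<in> hurwitz"
  \<comment> \<open>The parity of \<open>n\<close>, twice the real part, decides between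
    \<open>lipschitz\<close> and its coset by \<open>quat_omega\<close>.\<close>
  proof (cases "even n")
    case True
    then obtain m where "n = 2 * m" by blast
    then have "q = Quat (of_int m) (of_int (a + m)) (of_int (b + m)) (of_int (c + m))"
      using q by simp
    then show ?thesis unfolding hurwitz_def lipschitz_iff Un_iff by blast
  next
    case False
    then obtain m where "n = 2 * m + 1" by (blast elim: oddE)
    then have "q = quat_omega + Quat (of_int m) (of_int (a + m)) (of_int (b + m)) (of_int (c + m))"
      using q by (simp add: quat_omega_def quat_defs quat_i_def quat_j_def quat_k_def field_simps)
    moreover have "Quat (of_int m) (of_int (a + m)) (of_int (b + m)) (of_int (c + m)) \<in> lipschitz"
      unfolding lipschitz_iff by blast
    ultimately show ?thesis by (auto simp: hurwitz_def)
  qed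
qed

lemma lipschitz_subset_hurwitz: "lipschitz \<subseteq> hurwitz"
  by (simp add: hurwitz_def)

lemma hurwitz_add:
  assumes "p \<in> hurwitz" "q \<in> hurwitz"
  shows "p + q \<in> hurwitz"
proof -
  obtain n a b c :: int where p: "p = Quat (n / 2) (a + n / 2) (b + n / 2) (c + n / 2)"
    using assms(1) hurwitz_iff by blast
  obtain n' a' b' c' :: int where q: "q = Quat (n' / 2) (a' + n' / 2) (b' + n' / 2) (c' + n' / 2)"
    using assms(2) hurwitz_iff by blast
  have "p + q = Quat (of_int (n + n') / 2) (of_int (a + a') + of_int (n + n') / 2)
      (of_int (b + b') + of_int (n + n') / 2) (of_int (c + c') + of_int (n + n') / 2)"
    by (simp add: p q quat_defs field_simps)
  then show ?thesis unfolding hurwitz_iff by blast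
qed

lemma hurwitz_minus:
  assumes "p \<in> hurwitz"
  shows "- p \<in> hurwitz"
proof -
  obtain n a b c :: int where p: "p = Quat (n / 2) (a + n / 2) (b + n / 2) (c + n / 2)"
    using assms hurwitz_iff by blast
  have "- p = Quat (of_int (- n) / 2) (of_int (- a) + of_int (- n) / 2)
      (of_int (- b) + of_int (- n) / 2) (of_int (- c) + of_int (- n) / 2)"
    by (simp add: p quat_defs)
  then show ?thesis unfolding hurwitz_iff by blast
qed

lemma hurwitz_diff: "p \<in> hurwitz \<Longrightarrow> q \<in> hurwitz \<Longrightarrow> p - q \<in> hurwitz"
  using hurwitz_add[of p "- q"] hurwitz_minus[of q] by simp

lemma hurwitz_mult:
  assumes "p \<in> hurwitz" "q \<in> hurwitz"
  shows "p * q \<in> hurwitz"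
proof -
  obtain n a b c :: int where p: "p = Quat (n / 2) (a + n / 2) (b + n / 2) (c + n / 2)"
    using assms(1) hurwitz_iff by blast
  obtain n' a' b' c' :: int where q: "q = Quat (n' / 2) (a' + n' / 2) (b' + n' / 2) (c' + n' / 2)"
    using assms(2) hurwitz_iff by blast
  \<comment> \<open>Coordinates of the product in the basis \<omega>, i, j, k: \<open>N\<close> is
    twice its real part, and \<open>A\<close>, \<open>B\<close>, \<open>C\<close> are its imaginary
    coordinates minus its real part.\<close>
  define N where "N = - n * n' - 2 * (a * a' + b * b' + c * c') - n * (a' + b' + c') - n' * (a + b + c)"
  define A where "A = n * n' + a * a' + b * b' + c * c' + b * c' - c * b'
    + n * (a' + c') + n' * (a + b)"
  define B where "B = n * n' + a * a' + b * b' + c * c' + c * a' - a * c'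
    + n * (b' + a') + n' * (b + c)"
  define C where "C = n * n' + a * a' + b * b' + c * c' + a * b' - b * a'
    + n * (c' + b') + n' * (c + a)"
  have "p * q = Quat (of_int N / 2) (of_int A + of_int N / 2)
      (of_int B + of_int N / 2) (of_int C + of_int N / 2)"
    by (simp add: p q times_quat_def N_def A_def B_def C_def field_simps)
  then show ?thesis unfolding hurwitz_iff by blast
qed

lemma lipschitz_Quat [simp]: "Quat (of_int a) (of_int b) (of_int c) (of_int d) \<in> lipschitz"
  unfolding lipschitz_iff by blast

lemma of_int_in_hurwitz: "of_int n \<in> hurwitz"
  using lipschitz_Quat[of n 0 0 0] lipschitz_subset_hurwitz by (auto simp: of_int_quat)

lemma quat_units_in_hurwitz: "quat_i \<in> hurwitz" "quat_j \<in> hurwitz" "quat_k \<in> hurwitz"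
  using lipschitz_Quat[of 0 1 0 0] lipschitz_Quat[of 0 0 1 0] lipschitz_Quat[of 0 0 0 1]
    lipschitz_subset_hurwitz
  by (auto simp: quat_i_def quat_j_def quat_k_def)

lemma quat_of_gauss_in_hurwitz: "quat_of_gauss x \<in> hurwitz"
  by (simp add: quat_of_gauss_def hurwitz_add hurwitz_mult of_int_in_hurwitz quat_units_in_hurwitz)

lemma quat_conj_in_hurwitz: "p \<in> lipschitz \<Longrightarrow> quat_conj p \<in> hurwitz"
  using lipschitz_subset_hurwitz
  by (auto simp: lipschitz_iff quat_conj_def subset_iff) (metis of_int_minus)

lemmas hurwitz_intros = hurwitz_add hurwitz_minus hurwitz_diff hurwitz_mult of_int_in_hurwitz
  quat_units_in_hurwitz quat_of_gauss_in_hurwitz quat_conj_in_hurwitz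

section \<open>The right ideal generated by two Hurwitz integers\<close>

text \<open>A right ideal is the whole ring exactly when it contains 1: right multiplication by
  \<open>u\<close> turns a representation of 1 into one of \<open>u\<close>.\<close>

lemma right_ideal_eq_hurwitz_iff:
  assumes "p \<in> hurwitz" "q \<in> hurwitz"
  shows "p *o hurwitz + q *o hurwitz = hurwitz \<longleftrightarrow>
    (\<exists>g\<in>hurwitz. \<exists>h\<in>hurwitz. p * g + q * h = 1)"
    (is "?I = hurwitz \<longleftrightarrow> ?R")
proof
  assume "?I = hurwitz"
  then have "1 \<in> ?I" using of_int_in_hurwitz[of 1] by simp
  then show ?R by (auto simp: set_plus_def elt_set_times_def)
next
  assume ?R
  then obtain g h where gh: "g \<in> hurwitz" "h \<in> hurwitz" "p * g + q * h = 1" by blast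
  show "?I = hurwitz"
  proof
    show "?I \<subseteq> hurwitz"
      using assms by (auto simp: set_plus_def elt_set_times_def intro!: hurwitz_intros)
    show "hurwitz \<subseteq> ?I"
    proof
      fix u assume "u \<in> hurwitz"
      then have "g * u \<in> hurwitz" "h * u \<in> hurwitz" using gh by (auto intro: hurwitz_mult)
      moreover have "u = p * (g * u) + q * (h * u)"
        using gh(3) by (metis distrib_right mult.assoc mult_1_left)
      ultimately show "u \<in> ?I"
        by (metis set_plus_intro set_times_intro2)
    qed
  qed
qed

lemma quat_i_commutes_gauss: "quat_i * quat_of_gauss d = quat_of_gauss d * quat_i"
  by (simp add: quat_of_gauss_def of_int_quat quat_i_def quat_defs)

text \<open>A Hurwitz integer with a vanishing coordinate is Lipschitz, so the inverse \<open>h\<close> of \<open>d\<close>,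
  which lies in the span of \<open>1\<close> and \<open>i\<close>, is a Gaussian integer.\<close>

lemma gauss_unit_of_hurwitz_inverse:
  assumes "h \<in> hurwitz" "quat_of_gauss d * h = 1"
  shows "is_unit d"
proof -
  obtain n a b c :: int where h: "h = Quat (n / 2) (a + n / 2) (b + n / 2) (c + n / 2)"
    using assms(1) hurwitz_iff by blast
  let ?r = "real_of_int (gre d)" and ?s = "real_of_int (gim d)"
  have e: "?r * qre h - ?s * qi h = 1" "?r * qi h + ?s * qre h = 0"
    "?r * qj h - ?s * qk h = 0" "?r * qk h + ?s * qj h = 0"
    using assms(2) by (simp_all add: quat_of_gauss_def of_int_quat quat_i_def quat_defs)
  \<comment> \<open>The last two equations of \<open>e\<close> are a homogeneous linear system in
    \<open>qj h\<close> and \<open>qk h\<close> whose determinant is the norm of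
    \<open>d\<close>.\<close>
  have "(?r\<^sup>2 + ?s\<^sup>2) * qj h = ?r * (?r * qj h - ?s * qk h) + ?s * (?r * qk h + ?s * qj h)"
    by (simp add: power2_eq_square algebra_simps)
  then have "(?r\<^sup>2 + ?s\<^sup>2) * qj h = 0" using e by simp
  moreover have "?r\<^sup>2 + ?s\<^sup>2 \<noteq> 0" using e(1) by (auto simp: sum_power2_eq_zero_iff)
  ultimately have "qj h = 0" by (metis mult_eq_0_iff)
  \<comment> \<open>As \<open>qj h\<close> is \<open>b + n / 2\<close>, its vanishing forces
    \<open>n\<close> to be even, which removes the half-integers.\<close>
  then have "real_of_int n = real_of_int (2 * (- b))" using h by simp
  then have "n = 2 * (- b)" by (simp only: of_int_eq_iff)
  then have hh: "qre h = of_int (- b)" "qi h = of_int (a - b)" using h by simp_all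
  have "real_of_int (gre d * (- b) - gim d * (a - b)) = of_int 1"
    "real_of_int (gre d * (a - b) + gim d * (- b)) = of_int 0"
    using e(1,2) unfolding hh by simp_all
  then have "gre d * (- b) - gim d * (a - b) = 1" "gre d * (a - b) + gim d * (- b) = 0"
    by (simp_all only: of_int_eq_iff)
  then have "1 = d * Gauss (- b) (a - b)" by (simp add: gauss_defs)
  then show ?thesis by (rule dvdI)
qed

theorem proposition4p4:
  fixes z w :: gauss_int and \<gamma> :: quat
  assumes "\<gamma> \<in> lipschitz"
    and "\<gamma> = quat_of_gauss z + quat_of_gauss w * quat_j"
    and "\<exists>n::int. odd n \<and> quat_norm \<gamma> = of_int n"
  shows "(quat_i * \<gamma>) *o hurwitz + \<gamma> *o hurwitz = hurwitz \<longleftrightarrow> coprime z w"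
proof -
  have \<gamma>: "\<gamma> \<in> hurwitz" using assms(1) lipschitz_subset_hurwitz by blast
  have "(\<exists>g\<in>hurwitz. \<exists>h\<in>hurwitz. quat_i * \<gamma> * g + \<gamma> * h = 1) \<longleftrightarrow> coprime z w"
  proof
    assume "\<exists>g\<in>hurwitz. \<exists>h\<in>hurwitz. quat_i * \<gamma> * g + \<gamma> * h = 1"
    then obtain g h where gh: "g \<in> hurwitz" "h \<in> hurwitz" "quat_i * \<gamma> * g + \<gamma> * h = 1" by blast
    show "coprime z w"
    proof (rule coprimeI)
      fix d assume "d dvd z" "d dvd w"
      then obtain z' w' where "z = d * z'" "w = d * w'" by (auto elim!: dvdE)
      define \<delta> where "\<delta> = quat_of_gauss z' + quat_of_gauss w' * quat_j"
      have "\<gamma> = quat_of_gauss d * \<delta>"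
        using assms(2) \<open>z = d * z'\<close> \<open>w = d * w'\<close>
        by (simp add: \<delta>_def quat_of_gauss_hom distrib_left mult.assoc)
      then have "quat_of_gauss d * (quat_i * \<delta> * g + \<delta> * h) = 1"
        using gh(3) quat_i_commutes_gauss[of d] by (simp add: distrib_left flip: mult.assoc)
      moreover have "quat_i * \<delta> * g + \<delta> * h \<in> hurwitz"
        unfolding \<delta>_def using gh(1,2) by (intro hurwitz_intros)
      ultimately show "is_unit d" using gauss_unit_of_hurwitz_inverse by blast
    qed
  next
    assume "coprime z w"
    from coprime_gauss_bezout[OF this] obtain x y where "z * x + w * y = 1" .
    then have xy: "quat_of_gauss z * quat_of_gauss x + quat_of_gauss w * quat_of_gauss y = 1"
      by (metis quat_of_gauss_hom(2-4))
    obtain n where n: "odd n" "\<gamma> * quat_conj \<gamma> = of_int n"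
      using assms(3) by (auto simp: quat_norm_def)
    then obtain m where m: "n = 2 * m + 1" by (blast elim: oddE)
    define X where "X = quat_of_gauss x"
    define Y where "Y = quat_of_gauss y"
    \<comment> \<open>These are i\<gamma> + \<gamma>i = 2zi times -i and i\<gamma> - \<gamma>i = 2wk
      times -k, both on the right, using ik = -j.\<close>
    have two_z: "2 * quat_of_gauss z = \<gamma> - quat_i * \<gamma> * quat_i"
      and two_w: "2 * quat_of_gauss w = - (quat_i * \<gamma> * quat_k) - \<gamma> * quat_j"
      by (simp_all only: mult_2 assms(2) quat_of_gauss_plus_j)
        (simp_all add: quat_of_gauss_def of_int_quat quat_i_def quat_j_def quat_k_def quat_defs)
    have "(\<gamma> - quat_i * \<gamma> * quat_i) * X + (- (quat_i * \<gamma> * quat_k) - \<gamma> * quat_j) * Y = 2"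
      using xy unfolding two_z[symmetric] two_w[symmetric] X_def Y_def
      by (simp add: mult.assoc flip: distrib_left)
    then have two: "quat_i * \<gamma> * (- (quat_i * X + quat_k * Y)) + \<gamma> * (X - quat_j * Y) = 2"
      by (simp add: algebra_simps)
    define G where "G = - (quat_i * X + quat_k * Y)"
    define H where "H = X - quat_j * Y"
    \<comment> \<open>The norm is \<open>2 * m + 1\<close>, so subtracting \<open>m\<close> times
      the representation of 2 leaves 1; the integer \<open>m\<close> is central and can be moved
      into the cofactors.\<close>
    have "quat_i * \<gamma> * (- (G * of_int m)) + \<gamma> * (quat_conj \<gamma> - H * of_int m)
        = \<gamma> * quat_conj \<gamma> - (quat_i * \<gamma> * G + \<gamma> * H) * of_int m"
      by (simp add: algebra_simps)
    also have "\<dots> = 1"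
      using two n(2) m by (simp add: G_def H_def)
    finally have "quat_i * \<gamma> * (- (G * of_int m)) + \<gamma> * (quat_conj \<gamma> - H * of_int m) = 1" .
    moreover have "- (G * of_int m) \<in> hurwitz" "quat_conj \<gamma> - H * of_int m \<in> hurwitz"
      unfolding G_def H_def X_def Y_def using assms(1) by (intro hurwitz_intros; assumption)+
    ultimately show "\<exists>g\<in>hurwitz. \<exists>h\<in>hurwitz. quat_i * \<gamma> * g + \<gamma> * h = 1" by blast
  qed
  then show ?thesis
    using right_ideal_eq_hurwitz_iff[of "quat_i * \<gamma>" \<gamma>] \<gamma> by (simp add: hurwitz_intros)
qed

end
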